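(* Let $B\in\{1,\dots,9\}$, let $\tilde p\neq0$ be an integer and $\tilde q$ a positive integer with $\tilde q\geqslant 7\sqrt[3]{|\tilde p|}$. Put $F_3=B\tilde q^{4}-\tilde p\tilde q+\frac{16}{B}$. Then the equation $\tilde Q(t)=0$ has at least one real root $t$ with $F_3+\frac{32\tilde p}{B^{2}\tilde q^{3}}<t<F_3$ if $\tilde p<0$, respectively with $F_3<t<F_3+\frac{32\tilde p}{B^{2}\tilde q^{3}}$ if $\tilde p>0$.
   Context: For numbers $p,q$ let $$Q_{pq}(t)=t^{10}+(2q^{2}+p^{2})(3q^{2}-2p^{2})\,t^{8}+(q^{8}+10p^{2}q^{6}+4p^{4}q^{4}-14p^{6}q^{2}+p^{8})\,t^{6}-p^{2}q^{2}(q^{8}-14p^{2}q^{6}+4p^{4}q^{4}+10p^{6}q^{2}+p^{8})\,t^{4}-p^{6}q^{6}(q^{2}+2p^{2})(3p^{2}-2q^{2})\,t^{2}-q^{10}p^{10}.$$ Given $B$, $\tilde p$, $\tilde q$, define $\tilde Q(t)=Q_{pq}(t)$ with $p=B\tilde q^{3}-\tilde p$ and $q=\tilde q$. *)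

theory Defs
  imports Complex_Main
begin

definition Qpq :: "real \<Rightarrow> real \<Rightarrow> real \<Rightarrow> real" where
  "Qpq p q t =
     t^10
     + (2*q^2 + p^2) * (3*q^2 - 2*p^2) * t^8
     + (q^8 + 10*p^2*q^6 + 4*p^4*q^4 - 14*p^6*q^2 + p^8) * t^6
     - p^2*q^2 * (q^8 - 14*p^2*q^6 + 4*p^4*q^4 + 10*p^6*q^2 + p^8) * t^4
     - p^6*q^6 * (q^2 + 2*p^2) * (3*p^2 - 2*q^2) * t^2
     - q^10*p^10"

definition Q_tilde :: "real \<Rightarrow> real \<Rightarrow> real \<Rightarrow> real \<Rightarrow> real" where
  "Q_tilde B pt qt t = Qpq (B * qt^3 - pt) qt t"

definition F3 :: "real \<Rightarrow> real \<Rightarrow> real \<Rightarrow> real" where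
  "F3 B pt qt = B * qt^4 - pt * qt + 16 / B"

end

theory Submission
  imports Defs
begin

text \<open>
  With \<open>w = q\<^sup>2/p\<^sup>2\<close>, homogeneity turns \<open>Q\<^sub>p\<^sub>q(pq + y q\<^sup>3/p)\<close> into a positive multiple of
  \<open>2 (y - 16) - 128 w\<close> plus smaller terms for \<open>y\<close> near \<open>16\<close>. Hence \<open>Q\<^sub>p\<^sub>q\<close> is negative for \<open>y \<le> 16\<close>
  and positive as soon as \<open>y - 16\<close> exceeds a moderate multiple of \<open>w\<close>. For \<open>p = b q\<^sup>3 - u\<close> and
  \<open>\<epsilon> = u/(b q\<^sup>3)\<close> the ends of the interval are \<open>y = 16 (1 - \<epsilon>)\<close> and \<open>y = 16 (1 - \<epsilon>) (1 + 2 \<epsilon>)\<close>. They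
  lie about \<open>16 \<bar>\<epsilon>\<bar>\<close> to either side of \<open>16\<close>, while \<open>w\<close> is at most \<open>\<bar>\<epsilon>\<bar>/6\<close>, so the intermediate value
  theorem applies.
\<close>

definition reduced_Q_tail :: "real \<Rightarrow> real \<Rightarrow> real" where
  "reduced_Q_tail w v =
     (v - 1) * (v^4 + 4*v^2 + 1) + w * (6*v^4 + 10*v^3 + 14*v^2 + 2*v) + w^2 * (v^3 - v^2)"

definition reduced_Q :: "real \<Rightarrow> real \<Rightarrow> real" where
  "reduced_Q w v =
     v^3 - v^2 - w * (2*v^4 + 14*v^3 + 10*v^2 + 6*v) + w^2 * reduced_Q_tail w v"

lemma Qpq_eq_reduced_Q:
  assumes "p \<noteq> 0"
  shows "Qpq p q (p * q * s) = p^14 * q^6 * reduced_Q (q^2 / p^2) (s^2)"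
proof -
  define r where "r = q / p"
  have q_eq: "q = r * p" and ratio_eq: "q^2 / p^2 = r^2"
    using assms by (simp_all add: r_def power_divide)
  show ?thesis
    unfolding ratio_eq unfolding q_eq Qpq_def reduced_Q_def reduced_Q_tail_def by algebra
qed

lemma Qpq_at_offset:
  fixes p q y :: real
  assumes "p \<noteq> 0"
  defines "w \<equiv> q^2 / p^2"
  shows "Qpq p q (p * q + y * q^3 / p) = p^14 * q^6 * reduced_Q w (1 + w * (2*y + w * y^2))"
proof -
  have "p * q + y * q^3 / p = p * q * (1 + w * y)"
    using assms by (simp add: field_simps power2_eq_square power3_eq_cube)
  moreover have "(1 + w * y)^2 = 1 + w * (2*y + w * y^2)"
    by algebra
  ultimately show ?thesis
    using Qpq_eq_reduced_Q[OF assms(1)] by (simp add: w_def)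
qed

lemma reduced_Q_tail_bounds:
  assumes w: "0 \<le> w" "w \<le> 1/100" and v: "1 \<le> v" "v \<le> 2"
  shows "0 \<le> reduced_Q_tail w v" and "reduced_Q_tail w v \<le> 50"
proof -
  have v_powers: "v^2 \<le> 4" "v^3 \<le> 8" "v^4 \<le> 16" "v^2 \<le> v^3"
    using v power_mono[of v 2 2] power_mono[of v 2 3] power_mono[of v 2 4]
    by (simp_all add: power_increasing)
  show "0 \<le> reduced_Q_tail w v"
    using w v v_powers by (simp add: reduced_Q_tail_def)
  have "(v - 1) * (v^4 + 4*v^2 + 1) \<le> 1 * 33"
    using v v_powers by (intro mult_mono) simp_all
  moreover have "w * (6*v^4 + 10*v^3 + 14*v^2 + 2*v) \<le> 1/100 * 236"
    using w v v_powers by (intro mult_mono) simp_all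
  moreover have "v^3 - v^2 \<le> 8"
    using v_powers zero_le_power2[of v] by linarith
  then have "w^2 * (v^3 - v^2) \<le> 1 * 8"
    using w v_powers by (intro mult_mono power_le_one) simp_all
  ultimately show "reduced_Q_tail w v \<le> 50"
    by (simp add: reduced_Q_tail_def)
qed

text \<open>
  Here \<open>1 + w x\<close> stands for \<open>(1 + w y)\<^sup>2\<close>, so \<open>x - 32 = 2 (y - 16) + w y\<^sup>2\<close>, and near \<open>y = 16\<close> the gain
  \<open>w y\<^sup>2\<close> is about \<open>256 w\<close>. The quadratic \<open>2 x (38 - x)\<close> is written around \<open>x = 32\<close> to exhibit the
  leading loss \<open>384 w\<close>, which exceeds this gain.
\<close>

definition second_order_loss :: "real \<Rightarrow> real \<Rightarrow> real" where
  "second_order_loss w x =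
     384 - 2 * ((x - 32) * (x - 6)) + w * x^2 * (64 - x + 22 * (w * x) + 2 * (w * x)^2)
     - reduced_Q_tail w (1 + w * x)"

lemma reduced_Q_expansion: "reduced_Q w (1 + w * x) = w * (x - 32 - w * second_order_loss w x)"
  unfolding reduced_Q_def second_order_loss_def by algebra

lemma second_order_loss_gt:
  assumes w: "0 \<le> w" "w \<le> 1/1000" and x: "6 \<le> x" "x \<le> 65/2"
  shows "256 < second_order_loss w x"
proof -
  have "(x - 32) * (x - 6) \<le> 1/2 * (x - 6)"
    using x by (intro mult_right_mono) simp_all
  moreover have "0 \<le> w * x^2 * (64 - x + 22 * (w * x) + 2 * (w * x)^2)"
    using w x by simp
  moreover have "w * x \<le> 1/1000 * (65/2)"
    using w x by (intro mult_mono) simp_all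
  then have "reduced_Q_tail w (1 + w * x) \<le> 50"
    using w x by (intro reduced_Q_tail_bounds) simp_all
  ultimately show ?thesis
    using x by (simp add: second_order_loss_def)
qed

lemma second_order_loss_less:
  assumes w: "0 \<le> w" "w \<le> 1/1000" and x: "32 \<le> x" "x \<le> 37"
  shows "second_order_loss w x < 436"
proof -
  have wx: "0 \<le> w * x" "w * x \<le> 37/1000"
    using w x mult_mono[of w "1/1000" x 37] by simp_all
  have "0 \<le> (x - 32) * (x - 6)"
    using x by simp
  moreover have "w * x^2 * (64 - x + 22 * (w * x) + 2 * (w * x)^2) \<le> (1/1000 * 37^2) * 33"
    using w x wx power_mono[OF wx(2) wx(1), of 2]
    by (intro mult_mono power_mono) (simp_all add: power_divide)
  moreover have "0 \<le> reduced_Q_tail w (1 + w * x)"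
    using w wx by (intro reduced_Q_tail_bounds) simp_all
  ultimately show ?thesis
    by (simp add: second_order_loss_def)
qed

lemma reduced_Q_neg:
  assumes w: "0 < w" "w \<le> 1/1000" and y: "3 \<le> y" "y \<le> 16"
  shows "reduced_Q w (1 + w * (2*y + w * y^2)) < 0"
proof -
  define x where "x = 2*y + w * y^2"
  have "w * y^2 \<le> w * 256"
    using w y power_mono[of y 16 2] by simp
  then have x_le: "x \<le> 32 + 256 * w"
    using y by (simp add: x_def)
  have "6 \<le> x"
    using w y by (simp add: x_def add_increasing2)
  then have "w * 256 < w * second_order_loss w x"
    using w x_le by (intro mult_strict_left_mono second_order_loss_gt) simp_all
  then have "x - 32 - w * second_order_loss w x < 0"
    using x_le by simp
  then show ?thesis
    using w by (simp add: reduced_Q_expansion mult_pos_neg flip: x_def)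
qed

lemma reduced_Q_pos:
  assumes w: "0 < w" "w \<le> 1/1000" and y: "16 + 90 * w \<le> y" "y \<le> 18"
  shows "0 < reduced_Q w (1 + w * (2*y + w * y^2))"
proof -
  define x where "x = 2*y + w * y^2"
  have "w * 256 \<le> w * y^2"
    using w y power_mono[of 16 y 2] by simp
  then have x_ge: "32 + 436 * w \<le> x"
    using y by (simp add: x_def)
  have "w * y^2 \<le> 1/1000 * 18^2"
    using w y by (intro mult_mono power_mono) simp_all
  then have "x \<le> 37"
    using y by (simp add: x_def)
  then have "w * second_order_loss w x < w * 436"
    using w x_ge by (intro mult_strict_left_mono second_order_loss_less) simp_all
  then have "0 < x - 32 - w * second_order_loss w x"
    using x_ge by simp
  then show ?thesis
    using w by (simp add: reduced_Q_expansion flip: x_def)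
qed

lemma Qpq_neg:
  assumes "0 < p" "0 < q" "1000 * q^2 \<le> p^2" "3 \<le> y" "y \<le> 16"
  shows "Qpq p q (p * q + y * q^3 / p) < 0"
proof -
  have "reduced_Q (q^2 / p^2) (1 + q^2 / p^2 * (2*y + q^2 / p^2 * y^2)) < 0"
    using assms by (intro reduced_Q_neg) (simp_all add: divide_le_eq)
  then show ?thesis
    using assms by (subst Qpq_at_offset) (simp_all add: mult_pos_neg)
qed

lemma Qpq_pos:
  assumes "0 < p" "0 < q" "1000 * q^2 \<le> p^2" "16 + 90 * (q^2 / p^2) \<le> y" "y \<le> 18"
  shows "0 < Qpq p q (p * q + y * q^3 / p)"
proof -
  have "0 < reduced_Q (q^2 / p^2) (1 + q^2 / p^2 * (2*y + q^2 / p^2 * y^2))"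
    using assms by (intro reduced_Q_pos) (simp_all add: divide_le_eq)
  then show ?thesis
    using assms by (subst Qpq_at_offset) simp_all
qed

lemma isCont_Q_tilde: "isCont (Q_tilde b u q) t"
  unfolding Q_tilde_def Qpq_def by (intro continuous_intros)

lemma IVT_strict:
  fixes f :: "real \<Rightarrow> real"
  assumes "f a < 0" "0 < f b" "a \<le> b" "\<And>t. isCont f t"
  shows "\<exists>t. f t = 0 \<and> a < t \<and> t < b"
  using IVT[of f a 0 b] assms by (metis less_eq_real_def less_irrefl)

locale perturbed_cube =
  fixes b q u :: real
  assumes b_ge_1: "1 \<le> b" and q_pos: "0 < q"
    and abs_u_ge_1: "1 \<le> \<bar>u\<bar>" and abs_u_le: "343 * \<bar>u\<bar> \<le> q^3"
begin

definition p :: real where "p = b * q^3 - u"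

definition \<epsilon> :: real where "\<epsilon> = u / (b * q^3)"

lemma bq3_pos: "0 < b * q^3"
  using b_ge_1 q_pos by simp

lemma q_ge_7: "7 \<le> q"
proof (rule power_le_imp_le_base)
  show "7 ^ Suc 2 \<le> q ^ Suc 2"
    using abs_u_ge_1 abs_u_le by (simp add: numeral_3_eq_3)
qed (use q_pos in simp)

lemma abs_u_le_bq3: "343 * \<bar>u\<bar> \<le> b * q^3"
proof -
  have "1 * q^3 \<le> b * q^3"
    using b_ge_1 q_pos by (intro mult_right_mono) simp_all
  then show ?thesis
    using abs_u_le by simp
qed

lemma abs_eps_le: "\<bar>\<epsilon>\<bar> \<le> 1/343"
  using abs_u_le_bq3 bq3_pos by (simp add: \<epsilon>_def abs_divide field_simps)

lemma p_eq: "p = b * q^3 * (1 - \<epsilon>)"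
  using b_ge_1 q_pos by (simp add: p_def \<epsilon>_def right_diff_distrib)

lemma p_pos: "0 < p"
  using abs_u_le_bq3 bq3_pos by (simp add: p_def)

lemma p_square_ge: "6/7 * (b * q^3)^2 \<le> p^2"
proof -
  have "(342/343)^2 * (b * q^3)^2 \<le> p^2"
    unfolding power_mult_distrib[symmetric]
    using abs_u_le_bq3 bq3_pos by (intro power_mono) (simp_all add: p_def)
  moreover have "6/7 * (b * q^3)^2 \<le> (342/343)^2 * (b * q^3)^2"
    by (intro mult_right_mono) (simp_all add: power_divide)
  ultimately show ?thesis
    by linarith
qed

lemma q_square_le_p_square: "1000 * q^2 \<le> p^2"
proof -
  have "1000 * q^2 \<le> 6/7 * (1 * 7^4 * q^2)"
    by simp
  also have "1 * 7^4 * q^2 \<le> b^2 * q^4 * q^2"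
    using b_ge_1 q_ge_7 by (intro mult_mono power_mono one_le_power) simp_all
  also have "\<dots> = (b * q^3)^2"
    by algebra
  also note p_square_ge
  finally show ?thesis
    by simp
qed

lemma square_ratio_le_abs_eps: "6 * (q^2 / p^2) \<le> \<bar>\<epsilon>\<bar>"
proof -
  have "7 * (b * q^5) \<le> (b * q) * (b * q^5)"
    using b_ge_1 q_ge_7 mult_mono[of 1 b 7 q] by (intro mult_right_mono) simp_all
  also have "\<dots> = (b * q^3)^2"
    by algebra
  finally have "6 * (b * q^5) \<le> 1 * p^2"
    using p_square_ge by simp
  also have "\<dots> \<le> \<bar>u\<bar> * p^2"
    using abs_u_ge_1 by (intro mult_right_mono) simp_all
  finally have "6 * q^2 * (b * q^3) \<le> \<bar>u\<bar> * p^2"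
    by (simp add: mult_ac flip: power_add)
  then show ?thesis
    using bq3_pos p_pos by (simp add: \<epsilon>_def abs_divide field_simps)
qed

lemma Q_tilde_eq_Qpq: "Q_tilde b u q t = Qpq p q t"
  by (simp add: Q_tilde_def p_def)

lemma F3_add_eq_offset: "F3 b u q + 16 / b * c = p * q + 16 * (1 - \<epsilon>) * (1 + c) * q^3 / p"
proof -
  have "1 - \<epsilon> \<noteq> 0"
    using abs_eps_le by auto
  then have "16 * (1 - \<epsilon>) * (1 + c) * q^3 / p = 16 / b * (1 + c)"
    using b_ge_1 q_pos by (simp add: p_eq divide_simps) (simp add: algebra_simps)
  moreover have "F3 b u q = p * q + 16 / b"
    by (simp add: F3_def p_def left_diff_distrib power3_eq_cube power4_eq_xxxx)
  ultimately show ?thesis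
    by (simp add: distrib_left)
qed

lemma F3_eq_offset: "F3 b u q = p * q + (16 - 16 * \<epsilon>) * q^3 / p"
  using F3_add_eq_offset[of 0] by simp

lemma F3_shift_eq_offset:
  "F3 b u q + 32 * u / (b^2 * q^3) = p * q + (16 + 16 * \<epsilon> - 32 * \<epsilon>^2) * q^3 / p"
proof -
  have "32 * u / (b^2 * q^3) = 16 / b * (2 * \<epsilon>)"
    by (simp add: \<epsilon>_def power2_eq_square)
  moreover have "16 * (1 - \<epsilon>) * (1 + 2 * \<epsilon>) = 16 + 16 * \<epsilon> - 32 * \<epsilon>^2"
    by algebra
  ultimately show ?thesis
    using F3_add_eq_offset[of "2 * \<epsilon>"] by (simp only:)
qed

lemma eps_square_le: "343 * \<epsilon>^2 \<le> \<bar>\<epsilon>\<bar>"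
  using mult_left_mono[OF abs_eps_le, of "\<bar>\<epsilon>\<bar>"]
  by (simp add: power2_eq_square flip: abs_mult)

lemma root_above_F3:
  assumes "0 < u"
  shows "\<exists>t. Q_tilde b u q t = 0 \<and> F3 b u q < t \<and> t < F3 b u q + 32 * u / (b^2 * q^3)"
proof (rule IVT_strict)
  have "0 < \<epsilon>"
    using assms bq3_pos by (simp add: \<epsilon>_def)
  then show "Q_tilde b u q (F3 b u q) < 0"
    unfolding Q_tilde_eq_Qpq F3_eq_offset
    using abs_eps_le p_pos q_pos q_square_le_p_square by (intro Qpq_neg) simp_all
  show "0 < Q_tilde b u q (F3 b u q + 32 * u / (b^2 * q^3))"
    unfolding Q_tilde_eq_Qpq F3_shift_eq_offset
  proof (rule Qpq_pos[OF p_pos q_pos q_square_le_p_square])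
    show "16 + 90 * (q^2 / p^2) \<le> 16 + 16 * \<epsilon> - 32 * \<epsilon>^2"
      using \<open>0 < \<epsilon>\<close> square_ratio_le_abs_eps eps_square_le by linarith
    show "16 + 16 * \<epsilon> - 32 * \<epsilon>^2 \<le> 18"
      using abs_eps_le zero_le_power2[of \<epsilon>] by linarith
  qed
  show "F3 b u q \<le> F3 b u q + 32 * u / (b^2 * q^3)"
    using assms q_pos by simp
qed (rule isCont_Q_tilde)

lemma root_below_F3:
  assumes "u < 0"
  shows "\<exists>t. Q_tilde b u q t = 0 \<and> F3 b u q + 32 * u / (b^2 * q^3) < t \<and> t < F3 b u q"
proof (rule IVT_strict)
  have "\<epsilon> < 0"
    using assms bq3_pos by (simp add: \<epsilon>_def divide_neg_pos)
  show "Q_tilde b u q (F3 b u q + 32 * u / (b^2 * q^3)) < 0"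
    unfolding Q_tilde_eq_Qpq F3_shift_eq_offset
  proof (rule Qpq_neg[OF p_pos q_pos q_square_le_p_square])
    show "3 \<le> 16 + 16 * \<epsilon> - 32 * \<epsilon>^2"
      using abs_eps_le eps_square_le by linarith
    show "16 + 16 * \<epsilon> - 32 * \<epsilon>^2 \<le> 16"
      using \<open>\<epsilon> < 0\<close> zero_le_power2[of \<epsilon>] by linarith
  qed
  show "0 < Q_tilde b u q (F3 b u q)"
    unfolding Q_tilde_eq_Qpq F3_eq_offset
  proof (rule Qpq_pos[OF p_pos q_pos q_square_le_p_square])
    show "16 + 90 * (q^2 / p^2) \<le> 16 - 16 * \<epsilon>"
      using \<open>\<epsilon> < 0\<close> square_ratio_le_abs_eps by linarith
    show "16 - 16 * \<epsilon> \<le> 18"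
      using abs_eps_le by linarith
  qed
  show "F3 b u q + 32 * u / (b^2 * q^3) \<le> F3 b u q"
    using assms q_pos by (simp add: divide_nonpos_nonneg)
qed (rule isCont_Q_tilde)

end

theorem theorem4p3:
  fixes B pt qt :: int
  assumes "B \<in> {1..9}"
    and "pt \<noteq> 0"
    and "qt > 0"
    and "real_of_int qt \<ge> 7 * root 3 \<bar>real_of_int pt\<bar>"
  shows "(pt < 0 \<longrightarrow> (\<exists>t::real. Q_tilde (real_of_int B) (real_of_int pt) (real_of_int qt) t = 0
            \<and> F3 (real_of_int B) (real_of_int pt) (real_of_int qt)
                + 32 * real_of_int pt / ((real_of_int B)^2 * (real_of_int qt)^3) < t
            \<and> t < F3 (real_of_int B) (real_of_int pt) (real_of_int qt)))
       \<and> (pt > 0 \<longrightarrow> (\<exists>t::real. Q_tilde (real_of_int B) (real_of_int pt) (real_of_int qt) t = 0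
            \<and> F3 (real_of_int B) (real_of_int pt) (real_of_int qt) < t
            \<and> t < F3 (real_of_int B) (real_of_int pt) (real_of_int qt)
                + 32 * real_of_int pt / ((real_of_int B)^2 * (real_of_int qt)^3)))"
proof -
  interpret perturbed_cube "real_of_int B" "real_of_int qt" "real_of_int pt"
  proof
    have "(7 * root 3 \<bar>real_of_int pt\<bar>)^3 \<le> (real_of_int qt)^3"
      using assms(4) by (intro power_mono) simp_all
    then show "343 * \<bar>real_of_int pt\<bar> \<le> (real_of_int qt)^3"
      by (simp add: power_mult_distrib)
  qed (use assms(1-3) in simp_all)
  show ?thesis
    using root_below_F3 root_above_F3 by simp
qed

end
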